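(* Given any finite group $G$, there is a sequence of finite perfect groups $\{P_n\}_{n\in\mathbb{N}}$ and an ultrafilter $\omega$ on $\mathbb{N}$ such that the ultraproduct $\prod_{n\to\omega}P_n$ has a surjective homomorphism onto $G$.
   Context: For a sequence of groups $\{P_n\}_{n\in\mathbb{N}}$ and an ultrafilter $\omega$ on $\mathbb{N}$, the ultraproduct is the quotient group $\prod_{n\to\omega}P_n:=\left(\prod_{n\in\mathbb{N}}P_n\right)/N_\omega$, where $N_\omega=\{(g_n)_{n\in\mathbb{N}}\in\prod_{n\in\mathbb{N}}P_n : \{n: g_n=e\}\in\omega\}$. A group $P$ is perfect if $P=[P,P]$. *)

theory Defs
  imports "HOL-Algebra.Algebra"
begin

text \<open>
  An ultrafilter on a type, as a value of the library's filter type: a set \<open>A\<close> is a member of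
  \<open>\<omega>\<close> iff \<open>eventually (\<lambda>x. x \<in> A) \<omega>\<close>. Principal ultrafilters are included.
\<close>

definition ultrafilter :: "'i filter \<Rightarrow> bool"
  where "ultrafilter \<omega> \<longleftrightarrow>
    \<omega> \<noteq> bot \<and> (\<forall>A. eventually (\<lambda>x. x \<in> A) \<omega> \<or> eventually (\<lambda>x. x \<in> - A) \<omega>)"

definition ultra_null :: "'i filter \<Rightarrow> ('i \<Rightarrow> ('a, 'b) monoid_scheme) \<Rightarrow> ('i \<Rightarrow> 'a) set"
  where "ultra_null \<omega> P =
    {g \<in> carrier (product_group UNIV P). eventually (\<lambda>i. g i = \<one>\<^bsub>P i\<^esub>) \<omega>}"

definition ultraproduct ::
    "'i filter \<Rightarrow> ('i \<Rightarrow> ('a, 'b) monoid_scheme) \<Rightarrow> ('i \<Rightarrow> 'a) set monoid"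
  where "ultraproduct \<omega> P = product_group UNIV P Mod ultra_null \<omega> P"

definition perfect :: "('a, 'b) monoid_scheme \<Rightarrow> bool"
  where "perfect P \<longleftrightarrow> derived P (carrier P) = carrier P"

lemma ultra_null_normal:
  assumes P: "\<And>i. group (P i)"
  shows "ultra_null \<omega> P \<lhd> product_group UNIV P"
proof -
  interpret prod: group "product_group UNIV P"
    using P by simp
  show ?thesis
  proof (rule prod.normal_invI)
    show "subgroup (ultra_null \<omega> P) (product_group UNIV P)"
    proof (rule prod.subgroupI)
      show "ultra_null \<omega> P \<subseteq> carrier (product_group UNIV P)"
        by (auto simp: ultra_null_def)
      show "ultra_null \<omega> P \<noteq> {}"
        using prod.one_closed by (force simp: ultra_null_def)
    next
      fix g assume g: "g \<in> ultra_null \<omega> P"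
      then have "eventually (\<lambda>i. inv\<^bsub>P i\<^esub> g i = \<one>\<^bsub>P i\<^esub>) \<omega>"
        by (auto simp: ultra_null_def P group.is_monoid monoid.inv_one elim!: eventually_mono)
      with g show "inv\<^bsub>product_group UNIV P\<^esub> g \<in> ultra_null \<omega> P"
        by (auto simp: ultra_null_def P inv_product_group group.inv_closed PiE_iff)
    next
      fix g h assume gh: "g \<in> ultra_null \<omega> P" "h \<in> ultra_null \<omega> P"
      then have "eventually (\<lambda>i. g i = \<one>\<^bsub>P i\<^esub> \<and> h i = \<one>\<^bsub>P i\<^esub>) \<omega>"
        by (auto simp: ultra_null_def intro: eventually_conj)
      then have "eventually (\<lambda>i. g i \<otimes>\<^bsub>P i\<^esub> h i = \<one>\<^bsub>P i\<^esub>) \<omega>"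
        by eventually_elim (simp add: P group.is_monoid)
      with gh show "g \<otimes>\<^bsub>product_group UNIV P\<^esub> h \<in> ultra_null \<omega> P"
        by (auto simp: ultra_null_def P group.is_monoid monoid.m_closed PiE_iff)
    qed
  next
    fix x h
    assume x: "x \<in> carrier (product_group UNIV P)" and h: "h \<in> ultra_null \<omega> P"
    then have xP: "x i \<in> carrier (P i)" for i
      by auto
    have closed: "x \<otimes>\<^bsub>product_group UNIV P\<^esub> h \<otimes>\<^bsub>product_group UNIV P\<^esub> inv\<^bsub>product_group UNIV P\<^esub> x
        \<in> carrier (product_group UNIV P)"
      using x h by (auto simp: ultra_null_def simp del: carrier_product_group mult_product_group)
    have "eventually (\<lambda>i. h i = \<one>\<^bsub>P i\<^esub>) \<omega>"
      using h by (simp add: ultra_null_def)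
    then have "eventually (\<lambda>i. (x i \<otimes>\<^bsub>P i\<^esub> h i) \<otimes>\<^bsub>P i\<^esub> inv\<^bsub>P i\<^esub> x i = \<one>\<^bsub>P i\<^esub>) \<omega>"
      by eventually_elim (simp add: P xP group.is_monoid monoid.r_one group.r_inv)
    moreover have "inv\<^bsub>product_group UNIV P\<^esub> x = (\<lambda>i\<in>UNIV. inv\<^bsub>P i\<^esub> x i)"
      using x P by simp
    ultimately show "x \<otimes>\<^bsub>product_group UNIV P\<^esub> h \<otimes>\<^bsub>product_group UNIV P\<^esub> inv\<^bsub>product_group UNIV P\<^esub> x
        \<in> ultra_null \<omega> P"
      using closed by (simp add: ultra_null_def)
  qed
qed

lemma group_ultraproduct:
  assumes "\<And>i. group (P i)"
  shows "group (ultraproduct \<omega> P)"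
  unfolding ultraproduct_def
  by (rule normal.factorgroup_is_group[OF ultra_null_normal[OF assms]])

end

theory Submission
  imports Defs
begin

text \<open>
  A finite perfect group has no homomorphism onto \<open>G\<close> unless \<open>G\<close> is perfect, so the epimorphism
  cannot come from the factors. It is glued from homomorphisms that are defined on subgroups only:
  if, for growing \<open>k\<close>, every \<open>k\<close> elements of \<open>P\<^sub>n\<close> lie in a subgroup with a homomorphism to \<open>G\<close>,
  and these homomorphisms are jointly surjective, then a limit of them along an ultrafilter is
  defined on the whole ultraproduct.

  To construct such groups, fix a nontrivial finite perfect group \<open>S\<close>. The group \<open>S\<^sup>n\<close> acts on one copy
  of \<open>S\<close> for each pair \<open>(i, j)\<close> of indices, a tuple \<open>f\<close> sending \<open>s\<close> to \<open>f i \<cdot> s \<cdot> (f j)\<^sup>-\<^sup>1\<close>. The point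
  \<open>1\<close> of the copy \<open>(i, j)\<close> is fixed by \<open>f\<close> exactly when \<open>f i = f j\<close>. By the pigeonhole principle, as
  soon as \<open>n > card S ^ k\<close>, any \<open>k\<close> tuples fix a common such point with \<open>i \<noteq> j\<close>. In the wreath
  product of \<open>G\<close> by this action, evaluating the \<open>G\<close>-valued function at a point is a homomorphism on
  the stabilizer of that point, so the wreath product has enough local homomorphisms.

  The wreath product need not be perfect, but its perfect core is large enough: it is normal and
  contains the factors of \<open>S\<^sup>n\<close>, hence all their commutators with \<open>G\<close>-valued functions. If a function
  takes the value \<open>g\<close> at a single point, its commutator with a group element that moves the point
  still has the value \<open>g\<close> there; the compensating value \<open>g\<^sup>-\<^sup>1\<close> sits at another point of
  the same orbit and is invisible to the evaluation. Hence evaluation remains surjective on the core.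
  It is essential that \<open>i \<noteq> j\<close>, since otherwise the point \<open>1\<close> is never moved.

  The limit is taken along an ultrafilter on triples \<open>(n, i, j)\<close>, chosen by
  \<open>ex_ultrafilter_coincidences\<close> so that each sequence of elements fixes almost all of the points
  \<open>1\<close>; its image on the first coordinate is the ultrafilter of the ultraproduct. The two halves
  of the argument are \<open>ultraproduct_epi_of_local_homs\<close> and \<open>ex_perfect_group_with_local_homs\<close>.
\<close>

section \<open>Ultrafilters and ultralimits of local homomorphisms\<close>

text \<open>
  In the order on filters, finer means smaller, so Zorn's lemma is applied to the reversed order.
  A minimal proper filter \<open>U\<close> decides every set \<open>B\<close>: its restriction to \<open>B\<close> is either improper or
  equal to \<open>U\<close>.
\<close>

lemma ex_ultrafilter_le:
  fixes F :: "'i filter"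
  assumes "F \<noteq> bot"
  shows "\<exists>U. ultrafilter U \<and> U \<le> F"
proof -
  define A where "A = {U. U \<le> F \<and> U \<noteq> bot}"
  have "\<exists>U\<in>A. \<forall>U'\<in>A. U' \<le> U \<longrightarrow> U' = U"
  proof (rule predicate_Zorn)
    show "partial_order_on A (relation_of (\<lambda>U V. V \<le> U) A)"
      by (rule partial_order_on_relation_ofI) auto
  next
    fix C assume C: "C \<in> Chains (relation_of (\<lambda>U V. V \<le> U) A)"
    then have CA: "C \<subseteq> A" and tot: "\<And>U V. U \<in> C \<Longrightarrow> V \<in> C \<Longrightarrow> U \<le> V \<or> V \<le> U"
      by (auto simp: Chains_def relation_of_def)
    \<comment> \<open>Adding the top element \<open>F\<close> makes the chain nonempty without losing comparability.\<close>
    let ?C = "insert F C"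
    have tot': "U \<le> V \<or> V \<le> U" if "U \<in> ?C" "V \<in> ?C" for U V
      using that tot CA by (auto simp: A_def)
    have least: "\<exists>U\<in>?C. U \<le> Inf B" if "finite B" "B \<subseteq> ?C" for B
      using that
    proof (induction B rule: finite_induct)
      case (insert V B)
      then obtain U where U: "U \<in> ?C" "U \<le> Inf B" by auto
      have V: "V \<in> ?C" using insert.prems by simp
      from tot'[OF U(1) V] show ?case
      proof
        assume "U \<le> V" then show ?thesis using U by (intro bexI[of _ U]) simp_all
      next
        assume "V \<le> U" then show ?thesis using U(2) V by (intro bexI[of _ V]) simp_all
      qed
    qed auto
    have "(INF U\<in>?C. U) \<noteq> bot"
    proof (rule INF_filter_not_bot)
      fix B assume "B \<subseteq> ?C" "finite B"
      with least obtain U where "U \<in> ?C" "U \<le> Inf B" by blast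
      moreover have "U \<noteq> bot" using \<open>U \<in> ?C\<close> CA assms by (auto simp: A_def)
      ultimately show "(INF U\<in>B. U) \<noteq> bot" by (auto simp: bot_unique)
    qed
    then have "Inf ?C \<in> A" by (simp add: A_def)
    moreover have "Inf ?C \<le> V" if "V \<in> C" for V
      using that by (intro Inf_lower) simp
    ultimately show "\<exists>U\<in>A. \<forall>V\<in>C. U \<le> V" by blast
  qed
  then obtain U where U: "U \<le> F" "U \<noteq> bot"
    and least: "\<And>V. V \<le> F \<Longrightarrow> V \<noteq> bot \<Longrightarrow> V \<le> U \<Longrightarrow> V = U"
    by (auto simp: A_def)
  have "eventually (\<lambda>x. x \<in> B) U \<or> eventually (\<lambda>x. x \<in> - B) U" for B
  proof (cases "inf U (principal B) = bot")
    case True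
    then have "eventually (\<lambda>x. False) (inf U (principal B))" by simp
    then show ?thesis by (simp add: eventually_inf_principal)
  next
    case False
    then have "inf U (principal B) = U"
      using U by (intro least) (auto intro: le_infI1)
    then have "U \<le> principal B" by (metis inf_le2)
    then show ?thesis by (simp add: le_principal)
  qed
  with U show ?thesis by (auto simp: ultrafilter_def)
qed

lemma ultrafilter_filtermap:
  assumes "ultrafilter V"
  shows "ultrafilter (filtermap f V)"
proof -
  have "eventually (\<lambda>c. f c \<in> A) V \<or> eventually (\<lambda>c. f c \<in> - A) V" for A
  proof -
    have "eventually (\<lambda>c. c \<in> f -` A) V \<or> eventually (\<lambda>c. c \<in> - (f -` A)) V"
      using assms unfolding ultrafilter_def by blast
    then show ?thesis by simp
  qed
  then show ?thesis
    using assms by (simp add: ultrafilter_def eventually_filtermap filtermap_bot_iff)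
qed

lemma ultrafilter_finite_cases:
  assumes V: "ultrafilter V" and "finite A" and "eventually (\<lambda>c. f c \<in> A) V"
  shows "\<exists>a\<in>A. eventually (\<lambda>c. f c = a) V"
proof (rule ccontr)
  assume none: "\<not> ?thesis"
  have "eventually (\<lambda>c. f c \<noteq> a) V" if "a \<in> A" for a
  proof -
    have "eventually (\<lambda>c. c \<in> {c. f c = a}) V \<or> eventually (\<lambda>c. c \<in> - {c. f c = a}) V"
      using V unfolding ultrafilter_def by blast
    with none that show ?thesis by auto
  qed
  then have "eventually (\<lambda>c. \<forall>a\<in>A. f c \<noteq> a) V"
    using \<open>finite A\<close> by (simp add: eventually_ball_finite)
  with assms(3) have "eventually (\<lambda>c. False) V"
    by eventually_elim auto
  with V show False by (simp add: ultrafilter_def eventually_False)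
qed

text \<open>
  The index \<open>c\<close> names a map \<open>\<psi> c\<close> on the factor with index \<open>\<pi> c\<close>. Each \<open>\<psi> c\<close> may fail to be
  multiplicative at many places; what matters is that for any two given sequences it is
  multiplicative for almost all \<open>c\<close>. As \<open>G\<close> is finite, the values of \<open>\<psi> c\<close> on a given sequence
  are almost always one and the same element, which is the value of the limit. Pushing \<open>V\<close> forward
  along \<open>\<pi>\<close> makes a sequence that is trivial almost everywhere trivial for almost all \<open>c\<close>, and so
  the limit factors through the ultraproduct.
\<close>

lemma ultraproduct_epi_of_local_homs:
  fixes P :: "'i \<Rightarrow> ('p, 'q) monoid_scheme" and G :: "('a, 'b) monoid_scheme"
    and V :: "'c filter" and \<pi> :: "'c \<Rightarrow> 'i" and \<psi> :: "'c \<Rightarrow> 'p \<Rightarrow> 'a"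
  assumes V: "ultrafilter V"
    and P: "\<And>i. group (P i)"
    and G: "group G" "finite (carrier G)"
    and closed: "\<And>x. x \<in> carrier (product_group UNIV P) \<Longrightarrow>
      eventually (\<lambda>c. \<psi> c (x (\<pi> c)) \<in> carrier G) V"
    and mult: "\<And>x y. x \<in> carrier (product_group UNIV P) \<Longrightarrow> y \<in> carrier (product_group UNIV P) \<Longrightarrow>
      eventually (\<lambda>c. \<psi> c (x (\<pi> c) \<otimes>\<^bsub>P (\<pi> c)\<^esub> y (\<pi> c)) = \<psi> c (x (\<pi> c)) \<otimes>\<^bsub>G\<^esub> \<psi> c (y (\<pi> c))) V"
    and surj: "\<And>g. g \<in> carrier G \<Longrightarrow>
      \<exists>x\<in>carrier (product_group UNIV P). eventually (\<lambda>c. \<psi> c (x (\<pi> c)) = g) V"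
  shows "\<exists>\<phi>. \<phi> \<in> epi (ultraproduct (filtermap \<pi> V) P) G"
proof -
  let ?R = "product_group UNIV P"
  interpret G: group G by (rule G)
  interpret R: group ?R using P by simp
  have "\<exists>g\<in>carrier G. eventually (\<lambda>c. \<psi> c (x (\<pi> c)) = g) V" if "x \<in> carrier ?R" for x
    using ultrafilter_finite_cases[OF V G(2) closed[OF that]] .
  then obtain \<Phi> where \<Phi>: "\<And>x. x \<in> carrier ?R \<Longrightarrow> \<Phi> x \<in> carrier G"
      "\<And>x. x \<in> carrier ?R \<Longrightarrow> eventually (\<lambda>c. \<psi> c (x (\<pi> c)) = \<Phi> x) V"
    by metis
  have \<Phi>_eqI: "\<Phi> x = g" if "x \<in> carrier ?R" "eventually (\<lambda>c. \<psi> c (x (\<pi> c)) = g) V" for x g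
  proof -
    have "eventually (\<lambda>c. \<Phi> x = g) V"
      using that(2) \<Phi>(2)[OF that(1)] by eventually_elim simp
    then show ?thesis using V by (cases "\<Phi> x = g") (auto simp: ultrafilter_def eventually_False)
  qed
  have hom: "\<Phi> \<in> hom ?R G"
  proof (rule homI)
    fix x y assume x: "x \<in> carrier ?R" and y: "y \<in> carrier ?R"
    show "\<Phi> (x \<otimes>\<^bsub>?R\<^esub> y) = \<Phi> x \<otimes>\<^bsub>G\<^esub> \<Phi> y"
    proof (rule \<Phi>_eqI)
      show "x \<otimes>\<^bsub>?R\<^esub> y \<in> carrier ?R" using x y by (rule R.m_closed)
      show "eventually (\<lambda>c. \<psi> c ((x \<otimes>\<^bsub>?R\<^esub> y) (\<pi> c)) = \<Phi> x \<otimes>\<^bsub>G\<^esub> \<Phi> y) V"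
        using mult[OF x y] \<Phi>(2)[OF x] \<Phi>(2)[OF y] by eventually_elim simp
    qed
  qed (rule \<Phi>)
  interpret \<Phi>: group_hom ?R G \<Phi>
    using hom by unfold_locales
  have null: "ultra_null (filtermap \<pi> V) P \<subseteq> kernel ?R G \<Phi>"
  proof
    fix x assume "x \<in> ultra_null (filtermap \<pi> V) P"
    then have x: "x \<in> carrier ?R" and ev: "eventually (\<lambda>c. x (\<pi> c) = \<one>\<^bsub>P (\<pi> c)\<^esub>) V"
      by (auto simp: ultra_null_def eventually_filtermap)
    have "eventually (\<lambda>c. \<psi> c (x (\<pi> c)) = \<one>\<^bsub>G\<^esub>) V"
      using ev \<Phi>(2)[OF R.one_closed]
      by eventually_elim (use \<Phi>.hom_one in simp)
    with x show "x \<in> kernel ?R G \<Phi>"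
      by (simp only: kernel_def \<Phi>_eqI mem_Collect_eq)
  qed
  obtain \<phi> where \<phi>: "\<phi> \<in> hom (?R Mod ultra_null (filtermap \<pi> V) P) G"
      "\<And>x. x \<in> carrier ?R \<Longrightarrow> \<phi> (r_coset ?R (ultra_null (filtermap \<pi> V) P) x) = \<Phi> x"
    using \<Phi>.FactGroup_universal_kernel[OF ultra_null_normal[OF P] null] by blast
  have "carrier G \<subseteq> \<phi> ` carrier (ultraproduct (filtermap \<pi> V) P)"
  proof
    fix g assume "g \<in> carrier G"
    then obtain x where x: "x \<in> carrier ?R" "eventually (\<lambda>c. \<psi> c (x (\<pi> c)) = g) V"
      using surj by blast
    then have "\<phi> (r_coset ?R (ultra_null (filtermap \<pi> V) P) x) = g"
      using \<phi>(2) \<Phi>_eqI by simp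
    with x(1) show "g \<in> \<phi> ` carrier (ultraproduct (filtermap \<pi> V) P)"
      unfolding ultraproduct_def carrier_FactGroup by blast
  qed
  with \<phi>(1) show ?thesis
    unfolding ultraproduct_def[symmetric] by (auto simp: epi_iff_subset)
qed

section \<open>Perfect cores\<close>

lemma (in group) exp_of_derived_normal: "(derived G ^^ n) (carrier G) \<lhd> G"
  by (induction n) (simp_all add: normal_self derived_is_normal)

text \<open>
  The derived series of a finite group stabilizes, and its last term \<open>K\<close> equals its own derived
  subgroup. The homomorphic image of a perfect group equals its own derived subgroup too, so it lies in
  every term of the series.
\<close>

lemma (in group) ex_perfect_core:
  assumes "finite (carrier G)"
  shows "\<exists>K. K \<lhd> G \<and> derived G K = K \<and>
    (\<forall>(S :: ('s, 't) monoid_scheme) e. group S \<longrightarrow> perfect S \<longrightarrow> e \<in> hom S G \<longrightarrow> e ` carrier S \<subseteq> K)"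
proof -
  define D where "D n = (derived G ^^ n) (carrier G)" for n
  have D_normal: "D n \<lhd> G" for n
    unfolding D_def by (rule exp_of_derived_normal)
  have D_sub: "D n \<subseteq> carrier G" for n
    using D_normal normal_imp_subgroup subgroup.subset by blast
  have D_Suc: "D (Suc n) = derived G (D n)" for n
    by (simp add: D_def)
  have "\<exists>n. D (Suc n) = D n"
  proof -
    \<comment> \<open>A term of least cardinality cannot properly contain its successor.\<close>
    define n where "n = (ARG_MIN (\<lambda>n. card (D n)) n. True)"
    have "card (D n) \<le> card (D (Suc n))"
      unfolding n_def by (rule arg_min_nat_le) simp
    moreover have "D (Suc n) \<subseteq> D n"
      unfolding D_Suc
      using D_normal normal_imp_subgroup by (intro derived_incl) auto
    ultimately have "D (Suc n) = D n"
      using assms D_sub by (intro card_seteq) (auto intro: finite_subset)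
    then show ?thesis ..
  qed
  then obtain n where n: "derived G (D n) = D n" by (auto simp: D_Suc)
  have "e ` carrier S \<subseteq> D n" if S: "group S" "perfect S" "e \<in> hom S G"
    for S :: "('s, 't) monoid_scheme" and e
  proof (induction n)
    case 0
    then show ?case using S(3) by (auto simp: D_def hom_def)
  next
    case (Suc n)
    interpret e: group_hom S G e
      using S by (simp add: group_hom_def group_hom_axioms_def group_axioms)
    have "e ` carrier S = derived G (e ` carrier S)"
      using S(2) e.derived_img[of "carrier S"] by (simp add: perfect_def)
    also have "\<dots> \<subseteq> D (Suc n)"
      unfolding D_Suc by (rule mono_derived[OF Suc])
    finally show ?case .
  qed
  with n D_normal show ?thesis by blast
qed

section \<open>Permutational wreath products\<close>

text \<open>
  The semidirect product of the group of all functions \<open>E \<rightarrow> G\<close> with \<open>H\<close>, where \<open>h\<close> acts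
  on functions by \<open>v \<mapsto> v \<circ> \<alpha> (h\<^sup>-\<^sup>1)\<close>.
\<close>

definition wreath ::
    "('a, 'b) monoid_scheme \<Rightarrow> ('h, 'c) monoid_scheme \<Rightarrow> 'x set \<Rightarrow> ('h \<Rightarrow> 'x \<Rightarrow> 'x) \<Rightarrow> (('x \<Rightarrow> 'a) \<times> 'h) monoid"
  where "wreath G H E \<alpha> = \<lparr>carrier = (E \<rightarrow>\<^sub>E carrier G) \<times> carrier H,
    monoid.mult = (\<lambda>(u, h) (v, k). (\<lambda>x\<in>E. u x \<otimes>\<^bsub>G\<^esub> v (\<alpha> (inv\<^bsub>H\<^esub> h) x), h \<otimes>\<^bsub>H\<^esub> k)),
    one = (\<lambda>x\<in>E. \<one>\<^bsub>G\<^esub>, \<one>\<^bsub>H\<^esub>)\<rparr>"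

lemma wreath_simps:
  "carrier (wreath G H E \<alpha>) = (E \<rightarrow>\<^sub>E carrier G) \<times> carrier H"
  "(u, h) \<otimes>\<^bsub>wreath G H E \<alpha>\<^esub> (v, k) = (\<lambda>x\<in>E. u x \<otimes>\<^bsub>G\<^esub> v (\<alpha> (inv\<^bsub>H\<^esub> h) x), h \<otimes>\<^bsub>H\<^esub> k)"
  "\<one>\<^bsub>wreath G H E \<alpha>\<^esub> = (\<lambda>x\<in>E. \<one>\<^bsub>G\<^esub>, \<one>\<^bsub>H\<^esub>)"
  by (simp_all add: wreath_def)

locale wreath_product = G: group G + group_action H E \<alpha>
  for G :: "('a, 'b) monoid_scheme" (structure) and H :: "('h, 'c) monoid_scheme"
    and E :: "'x set" and \<alpha>
begin

abbreviation W where "W \<equiv> wreath G H E \<alpha>"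

sublocale H: group H
  using group_hom by (simp add: group_hom_def)

lemma val_closed: "u \<in> E \<rightarrow>\<^sub>E carrier G \<Longrightarrow> x \<in> E \<Longrightarrow> u x \<in> carrier G"
  by (rule PiE_mem)

lemma act_closed: "h \<in> carrier H \<Longrightarrow> x \<in> E \<Longrightarrow> \<alpha> h x \<in> E"
  using element_image by blast

lemma act_one: "x \<in> E \<Longrightarrow> \<alpha> \<one>\<^bsub>H\<^esub> x = x"
  by (metis id_eq_one restrict_apply')

lemma act_inv_act: "h \<in> carrier H \<Longrightarrow> x \<in> E \<Longrightarrow> \<alpha> (inv\<^bsub>H\<^esub> h) (\<alpha> h x) = x"
  using orbit_sym_aux by blast

lemma act_act_inv: "h \<in> carrier H \<Longrightarrow> x \<in> E \<Longrightarrow> \<alpha> h (\<alpha> (inv\<^bsub>H\<^esub> h) x) = x"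
  using act_inv_act[of "inv\<^bsub>H\<^esub> h" x] by simp

lemma group_wreath: "group W"
proof (rule groupI)
  fix w w' assume "w \<in> carrier W" "w' \<in> carrier W"
  then show "w \<otimes>\<^bsub>W\<^esub> w' \<in> carrier W"
    by (cases w; cases w') (auto simp: wreath_simps act_closed val_closed intro!: G.m_closed)
next
  show "\<one>\<^bsub>W\<^esub> \<in> carrier W" by (auto simp: wreath_simps)
next
  fix w w' w'' assume *: "w \<in> carrier W" "w' \<in> carrier W" "w'' \<in> carrier W"
  obtain u h v k r l where w: "w = (u, h)" "w' = (v, k)" "w'' = (r, l)"
    by (cases w; cases w'; cases w'')
  have "u x \<otimes> v (\<alpha> (inv\<^bsub>H\<^esub> h) x) \<otimes> r (\<alpha> (inv\<^bsub>H\<^esub> (h \<otimes>\<^bsub>H\<^esub> k)) x)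
      = u x \<otimes> (v (\<alpha> (inv\<^bsub>H\<^esub> h) x) \<otimes> r (\<alpha> (inv\<^bsub>H\<^esub> k) (\<alpha> (inv\<^bsub>H\<^esub> h) x)))" if "x \<in> E" for x
  proof -
    have "\<alpha> (inv\<^bsub>H\<^esub> (h \<otimes>\<^bsub>H\<^esub> k)) x = \<alpha> (inv\<^bsub>H\<^esub> k) (\<alpha> (inv\<^bsub>H\<^esub> h) x)"
      using * w that by (simp add: wreath_simps H.inv_mult_group composition_rule)
    then show ?thesis
      using * w that by (simp add: wreath_simps val_closed act_closed G.m_assoc)
  qed
  with * w show "w \<otimes>\<^bsub>W\<^esub> w' \<otimes>\<^bsub>W\<^esub> w'' = w \<otimes>\<^bsub>W\<^esub> (w' \<otimes>\<^bsub>W\<^esub> w'')"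
    by (auto simp: wreath_simps H.m_assoc act_closed intro!: restrict_ext)
next
  fix w assume "w \<in> carrier W"
  then show "\<one>\<^bsub>W\<^esub> \<otimes>\<^bsub>W\<^esub> w = w"
    by (cases w) (auto simp: wreath_simps act_one val_closed intro!: extensionalityI[of _ E],
        simp add: PiE_iff)
next
  fix w assume w: "w \<in> carrier W"
  obtain u h where uh: "w = (u, h)" by (cases w)
  have "(\<lambda>x\<in>E. inv u (\<alpha> h x), inv\<^bsub>H\<^esub> h) \<otimes>\<^bsub>W\<^esub> w = \<one>\<^bsub>W\<^esub>"
    using w uh by (auto simp: wreath_simps act_closed val_closed intro!: restrict_ext)
  moreover have "(\<lambda>x\<in>E. inv u (\<alpha> h x), inv\<^bsub>H\<^esub> h) \<in> carrier W"
    using w uh by (auto simp: wreath_simps act_closed val_closed)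
  ultimately show "\<exists>w'\<in>carrier W. w' \<otimes>\<^bsub>W\<^esub> w = \<one>\<^bsub>W\<^esub>" by blast
qed

sublocale W: group W by (rule group_wreath)

text \<open>Evaluation at \<open>x\<close> is a homomorphism on the stabilizer of \<open>x\<close>.\<close>

lemma wreath_eval_mult:
  assumes "(u, h) \<in> carrier W" "(v, k) \<in> carrier W" "x \<in> E" "\<alpha> h x = x"
  shows "fst ((u, h) \<otimes>\<^bsub>W\<^esub> (v, k)) x = u x \<otimes> v x"
proof -
  have "\<alpha> (inv\<^bsub>H\<^esub> h) x = x"
    using assms act_inv_act[of h x] by (simp add: wreath_simps)
  with assms show ?thesis by (simp add: wreath_simps)
qed

text \<open>
  The function displayed is the commutator of \<open>u\<close> and \<open>h\<close>, that is \<open>(u h u\<^sup>-\<^sup>1) h\<^sup>-\<^sup>1\<close>,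
  a product of elements of \<open>K\<close>.
\<close>

lemma commutator_in_normal:
  assumes K: "K \<lhd> W" and h: "(\<lambda>x\<in>E. \<one>, h) \<in> K" and u: "u \<in> (E \<rightarrow>\<^sub>E carrier G)"
  shows "(\<lambda>x\<in>E. u x \<otimes> inv u (\<alpha> (inv\<^bsub>H\<^esub> h) x), \<one>\<^bsub>H\<^esub>) \<in> K"
proof -
  interpret K: normal K W by (rule K)
  let ?u = "(u, \<one>\<^bsub>H\<^esub>)" and ?h = "(\<lambda>x\<in>E. \<one>, h)"
    and ?c = "(\<lambda>x\<in>E. u x \<otimes> inv u (\<alpha> (inv\<^bsub>H\<^esub> h) x), \<one>\<^bsub>H\<^esub>)"
  have hW: "?h \<in> carrier W" and uW: "?u \<in> carrier W"
    using h K.subset u by (auto simp: wreath_simps)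
  then have hH: "h \<in> carrier H" by (simp add: wreath_simps)
  have cW: "?c \<in> carrier W"
    using u hH by (auto simp: wreath_simps act_closed val_closed)
  have "?c \<otimes>\<^bsub>W\<^esub> (?h \<otimes>\<^bsub>W\<^esub> ?u) = ?u \<otimes>\<^bsub>W\<^esub> ?h"
    using u hH by (auto simp: wreath_simps act_closed act_one val_closed G.m_assoc intro!: restrict_ext)
  then have "?c = ?u \<otimes>\<^bsub>W\<^esub> ?h \<otimes>\<^bsub>W\<^esub> inv\<^bsub>W\<^esub> (?h \<otimes>\<^bsub>W\<^esub> ?u)"
    using cW hW uW by (intro W.inv_solve_right[THEN iffD2]) auto
  also have "\<dots> = (?u \<otimes>\<^bsub>W\<^esub> ?h \<otimes>\<^bsub>W\<^esub> inv\<^bsub>W\<^esub> ?u) \<otimes>\<^bsub>W\<^esub> inv\<^bsub>W\<^esub> ?h"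
    using hW uW by (simp add: W.inv_mult_group W.m_assoc)
  also have "\<dots> \<in> K"
    using h uW by (intro K.m_closed K.inv_op_closed2 K.m_inv_closed) auto
  finally show ?thesis .
qed

text \<open>
  If \<open>\<delta>\<close> is supported at \<open>b\<close> with value \<open>g\<close> and \<open>h\<close> moves \<open>b\<close>, the commutator of \<open>\<delta>\<close> and \<open>h\<close> has
  value \<open>g\<close> at \<open>b\<close>, value \<open>g\<^sup>-\<^sup>1\<close> at \<open>\<alpha> h b\<close>, and is trivial elsewhere. Since \<open>\<alpha> h b\<close> lies outside
  \<open>B\<close>, these commutators can be multiplied over the points of \<open>B\<close> without disturbing each other there.
\<close>

lemma normal_contains_prescribed_values:
  assumes K: "K \<lhd> W" and "finite B" "B \<subseteq> E" and g: "g \<in> carrier G"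
    and move: "\<And>b. b \<in> B \<Longrightarrow> \<exists>h\<in>carrier H. (\<lambda>x\<in>E. \<one>, h) \<in> K \<and> \<alpha> h b \<notin> B"
  shows "\<exists>u. (u, \<one>\<^bsub>H\<^esub>) \<in> K \<and> (\<forall>b\<in>B. u b = g)"
proof -
  interpret K: normal K W by (rule K)
  have "\<exists>u. (u, \<one>\<^bsub>H\<^esub>) \<in> K \<and> (\<forall>b\<in>B. u b = (if b \<in> B' then g else \<one>))" if "B' \<subseteq> B" for B'
    using finite_subset[OF that \<open>finite B\<close>] that
  proof (induction B' rule: finite_induct)
    case empty
    have "(\<lambda>x\<in>E. \<one>, \<one>\<^bsub>H\<^esub>) \<in> K" using K.one_closed by (simp add: wreath_simps)
    moreover have "\<forall>b\<in>B. (\<lambda>x\<in>E. \<one>) b = (if b \<in> {} then g else \<one>)"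
      using \<open>B \<subseteq> E\<close> by auto
    ultimately show ?case by blast
  next
    case (insert b B')
    then obtain u where u: "(u, \<one>\<^bsub>H\<^esub>) \<in> K" "\<forall>b\<in>B. u b = (if b \<in> B' then g else \<one>)" by auto
    have b: "b \<in> B" "b \<in> E" using insert.prems \<open>B \<subseteq> E\<close> by auto
    obtain h where h: "h \<in> carrier H" "(\<lambda>x\<in>E. \<one>, h) \<in> K" "\<alpha> h b \<notin> B"
      using move[OF b(1)] by blast
    define \<delta> where "\<delta> = (\<lambda>x\<in>E. if x = b then g else \<one>)"
    define c where "c = (\<lambda>x\<in>E. \<delta> x \<otimes> inv \<delta> (\<alpha> (inv\<^bsub>H\<^esub> h) x))"
    have "\<delta> \<in> (E \<rightarrow>\<^sub>E carrier G)" using g by (auto simp: \<delta>_def)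
    then have cK: "(c, \<one>\<^bsub>H\<^esub>) \<in> K"
      unfolding c_def by (rule commutator_in_normal[OF K h(2)])
    have c: "c x = (if x = b then g else \<one>)" if "x \<in> B" for x
    proof -
      have x: "x \<in> E" using that \<open>B \<subseteq> E\<close> by auto
      have "\<alpha> (inv\<^bsub>H\<^esub> h) x \<noteq> b"
        using act_act_inv[OF h(1) x] h(3) that by metis
      then show ?thesis
        using x g h(1) by (simp add: c_def \<delta>_def act_closed)
    qed
    have "(c, \<one>\<^bsub>H\<^esub>) \<otimes>\<^bsub>W\<^esub> (u, \<one>\<^bsub>H\<^esub>) \<in> K" using cK u(1) by (rule K.m_closed)
    then have "(\<lambda>x\<in>E. c x \<otimes> u x, \<one>\<^bsub>H\<^esub>) \<in> K"
      by (simp add: wreath_simps act_one cong: restrict_cong)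
    moreover have "\<forall>x\<in>B. (\<lambda>x\<in>E. c x \<otimes> u x) x = (if x \<in> insert b B' then g else \<one>)"
      using c u(2) g \<open>B \<subseteq> E\<close> insert.hyps by (auto simp: subset_iff)
    ultimately show ?case by blast
  qed
  from this[of B] show ?thesis by auto
qed

end

section \<open>Finite perfect groups with many local homomorphisms\<close>

lemma group_actionI:
  assumes "group H"
    and closed: "\<And>h x. h \<in> carrier H \<Longrightarrow> x \<in> E \<Longrightarrow> \<alpha> h x \<in> E"
    and ext: "\<And>h. h \<in> carrier H \<Longrightarrow> \<alpha> h \<in> extensional E"
    and one: "\<And>x. x \<in> E \<Longrightarrow> \<alpha> \<one>\<^bsub>H\<^esub> x = x"
    and mult: "\<And>h k x. h \<in> carrier H \<Longrightarrow> k \<in> carrier H \<Longrightarrow> x \<in> E \<Longrightarrow> \<alpha> (h \<otimes>\<^bsub>H\<^esub> k) x = \<alpha> h (\<alpha> k x)"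
  shows "group_action H E \<alpha>"
proof -
  interpret H: group H by (rule assms(1))
  have "\<alpha> h \<in> Bij E" if h: "h \<in> carrier H" for h
  proof -
    have "bij_betw (\<alpha> h) E E"
    proof (rule bij_betw_byWitness[where f' = "\<alpha> (inv\<^bsub>H\<^esub> h)"])
      show "\<forall>x\<in>E. \<alpha> (inv\<^bsub>H\<^esub> h) (\<alpha> h x) = x"
        using h mult[of "inv\<^bsub>H\<^esub> h" h] one by simp
      show "\<forall>x\<in>E. \<alpha> h (\<alpha> (inv\<^bsub>H\<^esub> h) x) = x"
        using h mult[of h "inv\<^bsub>H\<^esub> h"] one by simp
    qed (use h closed in auto)
    with ext[OF h] show ?thesis by (simp add: Bij_def)
  qed
  moreover have "\<alpha> (h \<otimes>\<^bsub>H\<^esub> k) = compose E (\<alpha> h) (\<alpha> k)" if "h \<in> carrier H" "k \<in> carrier H" for h k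
    using that ext mult by (intro extensionalityI[of _ E]) (auto simp: compose_def)
  ultimately have "\<alpha> \<in> hom H (BijGroup E)"
    by (auto simp: BijGroup_def hom_def)
  then show ?thesis
    by (simp add: group_action_def group_hom_def group_hom_axioms_def assms(1) group_BijGroup)
qed

definition coord_points :: "('s, 't) monoid_scheme \<Rightarrow> nat \<Rightarrow> (nat \<times> nat \<times> 's) set"
  where "coord_points S N = {..<N} \<times> {..<N} \<times> carrier S"

definition coord_act ::
    "('s, 't) monoid_scheme \<Rightarrow> nat \<Rightarrow> (nat \<Rightarrow> 's) \<Rightarrow> nat \<times> nat \<times> 's \<Rightarrow> nat \<times> nat \<times> 's"
  where "coord_act S N f =
    (\<lambda>p\<in>coord_points S N. case p of (i, j, s) \<Rightarrow> (i, j, f i \<otimes>\<^bsub>S\<^esub> s \<otimes>\<^bsub>S\<^esub> inv\<^bsub>S\<^esub> f j))"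

lemma (in group) coord_group_action:
  "group_action (product_group {..<N} (\<lambda>_. G)) (coord_points G N) (coord_act G N)"
proof (rule group_actionI)
  show "group (product_group {..<N} (\<lambda>_. G))" by simp
  fix f p assume f: "f \<in> carrier (product_group {..<N} (\<lambda>_. G))"
  show "coord_act G N f \<in> extensional (coord_points G N)" by (simp add: coord_act_def)
  assume "p \<in> coord_points G N"
  with f show "coord_act G N f p \<in> coord_points G N"
    by (auto simp: coord_act_def coord_points_def PiE_iff)
next
  fix p assume "p \<in> coord_points G N"
  then show "coord_act G N \<one>\<^bsub>product_group {..<N} (\<lambda>_. G)\<^esub> p = p"
    by (auto simp: coord_act_def coord_points_def)
next
  fix f f' p
  assume "f \<in> carrier (product_group {..<N} (\<lambda>_. G))" "f' \<in> carrier (product_group {..<N} (\<lambda>_. G))"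
    and "p \<in> coord_points G N"
  then show "coord_act G N (f \<otimes>\<^bsub>product_group {..<N} (\<lambda>_. G)\<^esub> f') p = coord_act G N f (coord_act G N f' p)"
    by (auto simp: coord_act_def coord_points_def PiE_iff inv_mult_group m_assoc)
qed

lemma (in group) coord_act_diagonal:
  assumes "f \<in> carrier (product_group {..<N} (\<lambda>_. G))" "i < N" "j < N" "f i = f j"
  shows "coord_act G N f (i, j, \<one>) = (i, j, \<one>)"
  using assms by (auto simp: coord_act_def coord_points_def PiE_iff)

lemma finite_perfect_group_iso_nat:
  fixes Q :: "('q, 't) monoid_scheme"
  assumes "group Q" "finite (carrier Q)" "perfect Q"
  shows "\<exists>(P :: nat monoid) \<tau>. group P \<and> finite (carrier P) \<and> perfect P \<and> \<tau> \<in> iso P Q"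
proof -
  interpret Q: group Q by (rule assms(1))
  obtain f :: "'q \<Rightarrow> nat" where f: "inj_on f (carrier Q)"
    using finite_imp_inj_to_nat_seg[OF assms(2)] by blast
  let ?P = "image_group f Q"
  have iso: "f \<in> iso Q ?P" by (rule inj_imp_image_group_iso[OF f])
  have P: "group ?P" by (rule Q.inj_imp_image_group_is_group[OF f])
  interpret f: group_hom Q ?P f
    using P iso by (simp add: group_hom_def group_hom_axioms_def Q.group_axioms iso_def)
  have "perfect ?P"
    using f.derived_img[of "carrier Q"] assms(3) by (simp add: perfect_def image_group_carrier)
  then show ?thesis
    using P Q.iso_set_sym[OF iso] assms(2) by (auto simp: image_group_carrier)
qed

text \<open>
  What the limit argument needs to know about \<open>P\<close>: each element \<open>p\<close> has a tuple \<open>f p\<close> of elements of \<open>A\<close>,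
  and wherever two entries of this tuple coincide, left multiplication by \<open>p\<close> is compatible with
  the corresponding evaluation \<open>v\<close>. For surjectivity, one element has to take the value \<open>g\<close> at all
  pairs \<open>i \<noteq> j\<close> simultaneously, because the ultrafilter that selects the pairs depends on all elements.
\<close>

definition coincidence_homs ::
    "'s set \<Rightarrow> ('a, 'b) monoid_scheme \<Rightarrow> nat \<Rightarrow> ('p, 'c) monoid_scheme \<Rightarrow>
      ('p \<Rightarrow> nat \<Rightarrow> 's) \<Rightarrow> ('p \<Rightarrow> nat \<Rightarrow> nat \<Rightarrow> 'a) \<Rightarrow> bool"
  where "coincidence_homs A G N P f v \<longleftrightarrow>
    (\<forall>p\<in>carrier P. f p \<in> {..<N} \<rightarrow> A) \<and>
    (\<forall>p\<in>carrier P. \<forall>i<N. \<forall>j<N. v p i j \<in> carrier G) \<and>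
    (\<forall>p\<in>carrier P. \<forall>q\<in>carrier P. \<forall>i<N. \<forall>j<N. f p i = f p j \<longrightarrow>
      v (p \<otimes>\<^bsub>P\<^esub> q) i j = v p i j \<otimes>\<^bsub>G\<^esub> v q i j) \<and>
    (\<forall>g\<in>carrier G. \<exists>p\<in>carrier P. \<forall>i<N. \<forall>j<N. i \<noteq> j \<longrightarrow> v p i j = g)"

lemma coincidence_homs_iso:
  assumes Q: "coincidence_homs A G N Q f v" and \<tau>: "\<tau> \<in> iso P Q"
  shows "coincidence_homs A G N P (f \<circ> \<tau>) (v \<circ> \<tau>)"
proof -
  have mem: "\<tau> p \<in> carrier Q" if "p \<in> carrier P" for p
    using \<tau> that by (auto simp: iso_def hom_def)
  have mult: "\<tau> (p \<otimes>\<^bsub>P\<^esub> q) = \<tau> p \<otimes>\<^bsub>Q\<^esub> \<tau> q" if "p \<in> carrier P" "q \<in> carrier P" for p q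
    using \<tau> that by (auto simp: iso_def hom_def)
  have surj: "carrier Q = \<tau> ` carrier P"
    using \<tau> by (auto simp: iso_def bij_betw_def)
  show ?thesis
    using Q unfolding coincidence_homs_def by (simp add: mem mult) (simp add: surj)
qed

text \<open>
  The group is the perfect core \<open>K\<close> of the wreath product of \<open>G\<close> by the action of \<open>S\<^sup>N\<close> above, and the
  evaluations are taken at the points \<open>(i, j, \<one>)\<close>. The core contains the \<open>i\<close>-th factor of \<open>S\<^sup>N\<close>, and the
  element \<open>y\<close> of this factor moves \<open>(i, j, \<one>)\<close> to \<open>(i, j, y)\<close> when \<open>i \<noteq> j\<close>; hence the values
  at all these points can be prescribed within the core.
\<close>

lemma ex_perfect_group_with_local_homs:
  fixes G :: "('a, 'b) monoid_scheme" and S :: "('s, 't) monoid_scheme"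
  assumes G: "group G" "finite (carrier G)"
    and S: "group S" "finite (carrier S)" "perfect S" and y: "y \<in> carrier S" "y \<noteq> \<one>\<^bsub>S\<^esub>"
  shows "\<exists>(P :: nat monoid) f v. group P \<and> finite (carrier P) \<and> perfect P \<and>
    coincidence_homs (carrier S) G N P f v"
proof -
  interpret S: group S by (rule S)
  let ?H = "product_group {..<N} (\<lambda>_. S)" and ?E = "coord_points S N" and ?\<alpha> = "coord_act S N"
  interpret wreath_product G ?H ?E ?\<alpha>
    using G(1) S.coord_group_action by (simp add: wreath_product_def)
  have finE: "finite ?E" using S(2) by (simp add: coord_points_def)
  have finW: "finite (carrier W)"
    using finE G(2) S(2) by (simp add: wreath_simps finite_PiE)
  obtain K where K: "K \<lhd> W" "derived W K = K"
    and core: "\<And>e. e \<in> hom S W \<Longrightarrow> e ` carrier S \<subseteq> K"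
    using W.ex_perfect_core[OF finW, where 's = 's and 't = 't] S by blast
  interpret K: normal K W by (rule K)
  define coord where "coord i s = (\<lambda>j\<in>{..<N}. if j = i then s else \<one>\<^bsub>S\<^esub>)" for i s
  have coordK: "(\<lambda>x\<in>?E. \<one>\<^bsub>G\<^esub>, coord i s) \<in> K" if "s \<in> carrier S" for i s
  proof -
    have "(\<lambda>s. (\<lambda>x\<in>?E. \<one>\<^bsub>G\<^esub>, coord i s)) \<in> hom S W"
    proof (rule homI)
      fix s assume "s \<in> carrier S"
      then show "(\<lambda>x\<in>?E. \<one>\<^bsub>G\<^esub>, coord i s) \<in> carrier W"
        by (auto simp: wreath_simps coord_def)
    next
      fix s s' assume s: "s \<in> carrier S" "s' \<in> carrier S"
      then have "coord i s \<in> carrier ?H" by (auto simp: coord_def)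
      moreover have "coord i (s \<otimes>\<^bsub>S\<^esub> s') = coord i s \<otimes>\<^bsub>?H\<^esub> coord i s'"
        using s by (auto simp: coord_def)
      ultimately show "(\<lambda>x\<in>?E. \<one>\<^bsub>G\<^esub>, coord i (s \<otimes>\<^bsub>S\<^esub> s')) =
          (\<lambda>x\<in>?E. \<one>\<^bsub>G\<^esub>, coord i s) \<otimes>\<^bsub>W\<^esub> (\<lambda>x\<in>?E. \<one>\<^bsub>G\<^esub>, coord i s')"
        using act_closed[OF H.inv_closed] unfolding wreath_simps by (auto cong: restrict_cong)
    qed
    from core[OF this] that show ?thesis by blast
  qed
  define B where "B = {(i, j, s). i < N \<and> j < N \<and> i \<noteq> j \<and> s = \<one>\<^bsub>S\<^esub>}"
  have BE: "B \<subseteq> ?E" by (auto simp: B_def coord_points_def)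
  have prescribed: "\<exists>u. (u, \<one>\<^bsub>?H\<^esub>) \<in> K \<and> (\<forall>b\<in>B. u b = g)" if "g \<in> carrier G" for g
  proof (rule normal_contains_prescribed_values[OF K(1) finite_subset[OF BE finE] BE that])
    fix b assume "b \<in> B"
    then obtain i j where b: "b = (i, j, \<one>\<^bsub>S\<^esub>)" "i < N" "j < N" "i \<noteq> j" by (auto simp: B_def)
    then have "?\<alpha> (coord i y) b = (i, j, y)"
      using y by (simp add: coord_act_def coord_points_def coord_def)
    then have "?\<alpha> (coord i y) b \<notin> B" using y by (simp add: B_def)
    moreover have "coord i y \<in> carrier ?H" using y by (auto simp: coord_def)
    ultimately show "\<exists>h\<in>carrier ?H. (\<lambda>x\<in>?E. \<one>\<^bsub>G\<^esub>, h) \<in> K \<and> ?\<alpha> h b \<notin> B"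
      using coordK[OF y(1)] by blast
  qed
  have K_W: "w \<in> carrier W" if "w \<in> K" for w using that K.subset by blast
  let ?P = "W\<lparr>carrier := K\<rparr>"
  have "group ?P"
    by (rule W.subgroup_imp_group[OF K.subgroup_axioms])
  moreover have "finite (carrier ?P)"
    using finW K.subset by (auto intro: finite_subset)
  moreover have "perfect ?P"
    using W.derived_consistent[OF order_refl K.subgroup_axioms] K(2) by (simp add: perfect_def)
  moreover have "coincidence_homs (carrier S) G N ?P snd (\<lambda>w i j. fst w (i, j, \<one>\<^bsub>S\<^esub>))"
    unfolding coincidence_homs_def
  proof (intro conjI ballI allI impI)
    fix w assume w: "w \<in> carrier ?P"
    then have wW: "w \<in> carrier W" by (simp add: K_W)
    then show "snd w \<in> {..<N} \<rightarrow> carrier S" by (auto simp: wreath_simps)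
    fix i j assume ij: "i < N" "j < N"
    then have pE: "(i, j, \<one>\<^bsub>S\<^esub>) \<in> ?E" by (simp add: coord_points_def)
    with wW show "fst w (i, j, \<one>\<^bsub>S\<^esub>) \<in> carrier G"
      by (auto simp: wreath_simps intro: val_closed)
    fix w' assume "w' \<in> carrier ?P" and eq: "snd w i = snd w j"
    then have w'W: "w' \<in> carrier W" by (simp add: K_W)
    have "?\<alpha> (snd w) (i, j, \<one>\<^bsub>S\<^esub>) = (i, j, \<one>\<^bsub>S\<^esub>)"
      using wW ij eq by (intro S.coord_act_diagonal) (auto simp: wreath_simps)
    then show "fst (w \<otimes>\<^bsub>?P\<^esub> w') (i, j, \<one>\<^bsub>S\<^esub>) = fst w (i, j, \<one>\<^bsub>S\<^esub>) \<otimes>\<^bsub>G\<^esub> fst w' (i, j, \<one>\<^bsub>S\<^esub>)"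
      using wreath_eval_mult[of "fst w" "snd w" "fst w'" "snd w'" "(i, j, \<one>\<^bsub>S\<^esub>)"] wW w'W pE by simp
  next
    fix g assume "g \<in> carrier G"
    from prescribed[OF this] obtain u where "(u, \<one>\<^bsub>?H\<^esub>) \<in> K" "\<forall>b\<in>B. u b = g" by blast
    then show "\<exists>w\<in>carrier ?P. \<forall>i<N. \<forall>j<N. i \<noteq> j \<longrightarrow> fst w (i, j, \<one>\<^bsub>S\<^esub>) = g"
      by (intro bexI[of _ "(u, \<one>\<^bsub>?H\<^esub>)"]) (auto simp: B_def)
  qed
  then have "\<exists>f v. coincidence_homs (carrier S) G N P f v" if "\<tau> \<in> iso P ?P"
    for P :: "nat monoid" and \<tau>
    using coincidence_homs_iso[OF _ that] by (intro exI)
  ultimately show ?thesis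
    using finite_perfect_group_iso_nat[of ?P] by meson
qed

section \<open>The choice of the ultrafilter\<close>

lemma ex_nontrivial_finite_perfect_group:
  "\<exists>(S :: (nat \<Rightarrow> nat) monoid) y. group S \<and> finite (carrier S) \<and> perfect S \<and> y \<in> carrier S \<and> y \<noteq> \<one>\<^bsub>S\<^esub>"
proof -
  have "card (carrier (alt_group 5)) = 60"
    using alt_group_card_carrier[of 5] by (simp add: fact_numeral)
  moreover from this have "finite (carrier (alt_group 5))"
    by (intro card_ge_0_finite) simp
  moreover from calculation have "\<not> carrier (alt_group 5) \<subseteq> {\<one>\<^bsub>alt_group 5\<^esub>}"
    using card_mono[of "{\<one>\<^bsub>alt_group 5\<^esub>}" "carrier (alt_group 5)"] by auto
  ultimately show ?thesis
    using alt_group_is_group derived_alt_group_const[of 5] unfolding perfect_def by blast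
qed

text \<open>
  Finitely many tuples \<open>f n\<close> of length \<open>n\<close> combine into one map from \<open>{..<n}\<close> to a set whose size
  does not depend on \<open>n\<close>, and this map is not injective for large \<open>n\<close>. So the sets of coincidences of the
  members of \<open>\<F>\<close> have the finite intersection property, however large \<open>\<F>\<close> is.
\<close>

lemma ex_ultrafilter_coincidences:
  fixes \<F> :: "(nat \<Rightarrow> nat \<Rightarrow> 's) set"
  assumes "finite A" and \<F>: "\<And>f n. f \<in> \<F> \<Longrightarrow> f n \<in> {..<n} \<rightarrow> A"
  shows "\<exists>V :: (nat \<times> nat \<times> nat) filter. ultrafilter V \<and>
    (\<forall>f\<in>\<F>. eventually (\<lambda>(n, i, j). i < n \<and> j < n \<and> i \<noteq> j \<and> f n i = f n j) V)"
proof -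
  define C where "C f = {(n, i, j). i < n \<and> j < n \<and> i \<noteq> j \<and> f n i = f n j}" for f :: "nat \<Rightarrow> nat \<Rightarrow> 's"
  have "(INF f\<in>\<F>. principal (C f)) \<noteq> bot"
  proof (rule INF_filter_not_bot)
    fix F assume F: "F \<subseteq> \<F>" "finite F"
    define n where "n = Suc (card (F \<rightarrow>\<^sub>E A))"
    have "(\<lambda>i. \<lambda>f\<in>F. f n i) ` {..<n} \<subseteq> F \<rightarrow>\<^sub>E A"
      using F \<F> by (auto simp: Pi_iff)
    moreover have "finite (F \<rightarrow>\<^sub>E A)"
      using F(2) assms(1) by (simp add: finite_PiE)
    ultimately have "card ((\<lambda>i. \<lambda>f\<in>F. f n i) ` {..<n}) < card {..<n}"
      by (simp add: n_def card_mono le_imp_less_Suc)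
    then have "\<not> inj_on (\<lambda>i. \<lambda>f\<in>F. f n i) {..<n}" by (rule pigeonhole)
    then obtain i j where ij: "i < n" "j < n" "i \<noteq> j" "(\<lambda>f\<in>F. f n i) = (\<lambda>f\<in>F. f n j)"
      by (auto simp: inj_on_def)
    have "f n i = f n j" if "f \<in> F" for f
      using fun_cong[OF ij(4), of f] that by simp
    with ij have "(n, i, j) \<in> (\<Inter>f\<in>F. C f)" by (auto simp: C_def)
    then have "(\<Inter>f\<in>F. C f) \<noteq> {}" by blast
    then show "(INF f\<in>F. principal (C f)) \<noteq> bot"
      unfolding INF_principal_finite[OF F(2)] by (simp only: principal_eq_bot_iff not_False_eq_True)
  qed
  then obtain V where V: "ultrafilter V" "V \<le> (INF f\<in>\<F>. principal (C f))"
    using ex_ultrafilter_le by blast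
  have "eventually (\<lambda>p. p \<in> C f) V" if "f \<in> \<F>" for f
  proof (rule filter_leD[OF V(2)])
    show "eventually (\<lambda>p. p \<in> C f) (INF f\<in>\<F>. principal (C f))"
      using that by (rule eventually_INF1) (simp add: eventually_principal)
  qed
  with V(1) show ?thesis by (auto simp: C_def case_prod_unfold)
qed

theorem theorem1p6:
  fixes G :: "('a, 'b) monoid_scheme"
  assumes "group G" and "finite (carrier G)"
  shows "\<exists>(P :: nat \<Rightarrow> nat monoid) (\<omega> :: nat filter).
           (\<forall>n. group (P n) \<and> finite (carrier (P n)) \<and> perfect (P n)) \<and>
           ultrafilter \<omega> \<and>
           (\<exists>\<phi>. \<phi> \<in> epi (ultraproduct \<omega> P) G)"
proof -
  obtain S :: "(nat \<Rightarrow> nat) monoid" and y where S: "group S" "finite (carrier S)" "perfect S"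
      "y \<in> carrier S" "y \<noteq> \<one>\<^bsub>S\<^esub>"
    using ex_nontrivial_finite_perfect_group by (elim exE conjE) (rule that)
  have "\<forall>n. \<exists>(P :: nat monoid) f v. group P \<and> finite (carrier P) \<and> perfect P \<and>
      coincidence_homs (carrier S) G n P f v"
    using ex_perfect_group_with_local_homs[OF assms S] by (rule allI)
  from choice[OF this] obtain P :: "nat \<Rightarrow> nat monoid"
    where P_ex: "\<forall>n. \<exists>f v. group (P n) \<and> finite (carrier (P n)) \<and> perfect (P n) \<and>
      coincidence_homs (carrier S) G n (P n) f v" ..
  then have P: "\<And>n. group (P n)" "\<And>n. finite (carrier (P n))" "\<And>n. perfect (P n)"
    by blast+
  from P_ex have "\<forall>n. \<exists>f v. coincidence_homs (carrier S) G n (P n) f v" by blast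
  from choice[OF this] obtain f where "\<forall>n. \<exists>v. coincidence_homs (carrier S) G n (P n) (f n) v" ..
  from choice[OF this] obtain v where fv: "coincidence_homs (carrier S) G n (P n) (f n) (v n)" for n
    by blast
  let ?R = "product_group UNIV P"
  have P_mem: "x n \<in> carrier (P n)" if "x \<in> carrier ?R" for x n
    using that by auto
  have f_closed: "f n p \<in> {..<n} \<rightarrow> carrier S" if "p \<in> carrier (P n)" for n p
    using fv[of n] that unfolding coincidence_homs_def by blast
  let ?\<F> = "(\<lambda>x n. f n (x n)) ` carrier ?R"
  have "\<exists>V :: (nat \<times> nat \<times> nat) filter. ultrafilter V \<and>
      (\<forall>F\<in>?\<F>. eventually (\<lambda>(n, i, j). i < n \<and> j < n \<and> i \<noteq> j \<and> F n i = F n j) V)"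
    by (rule ex_ultrafilter_coincidences[OF S(2)]) (use f_closed P_mem in blast)
  then obtain V :: "(nat \<times> nat \<times> nat) filter" where V: "ultrafilter V"
    and V_\<F>: "\<forall>F\<in>?\<F>. eventually (\<lambda>(n, i, j). i < n \<and> j < n \<and> i \<noteq> j \<and> F n i = F n j) V"
    by blast
  have coincide: "eventually (\<lambda>(n, i, j). i < n \<and> j < n \<and> i \<noteq> j \<and> f n (x n) i = f n (x n) j) V"
    if "x \<in> carrier ?R" for x
    using bspec[OF V_\<F> imageI[OF that]] by simp
  define \<psi> where "\<psi> = (\<lambda>(n, i, j) p. v n p i j)"
  have "\<exists>\<phi>. \<phi> \<in> epi (ultraproduct (filtermap fst V) P) G"
  proof (rule ultraproduct_epi_of_local_homs[where \<psi> = \<psi>])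
    fix x assume x: "x \<in> carrier ?R"
    have "v n (x n) i j \<in> carrier G" if "i < n" "j < n" for n i j
      using fv[of n] P_mem[OF x, of n] that unfolding coincidence_homs_def by blast
    with coincide[OF x] show "eventually (\<lambda>c. \<psi> c (x (fst c)) \<in> carrier G) V"
      by (auto simp: \<psi>_def elim!: eventually_mono)
    fix y assume y: "y \<in> carrier ?R"
    have "v n (x n \<otimes>\<^bsub>P n\<^esub> y n) i j = v n (x n) i j \<otimes>\<^bsub>G\<^esub> v n (y n) i j"
      if "i < n" "j < n" "f n (x n) i = f n (x n) j" for n i j
      using fv[of n] P_mem[OF x, of n] P_mem[OF y, of n] that unfolding coincidence_homs_def by blast
    with coincide[OF x] show "eventually (\<lambda>c. \<psi> c (x (fst c) \<otimes>\<^bsub>P (fst c)\<^esub> y (fst c))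
        = \<psi> c (x (fst c)) \<otimes>\<^bsub>G\<^esub> \<psi> c (y (fst c))) V"
      by (auto simp: \<psi>_def elim!: eventually_mono)
  next
    fix g assume "g \<in> carrier G"
    then have "\<exists>p\<in>carrier (P n). \<forall>i<n. \<forall>j<n. i \<noteq> j \<longrightarrow> v n p i j = g" for n
      using fv[of n] unfolding coincidence_homs_def by blast
    then obtain x where x: "\<And>n. x n \<in> carrier (P n)"
        "\<And>n i j. i < n \<Longrightarrow> j < n \<Longrightarrow> i \<noteq> j \<Longrightarrow> v n (x n) i j = g"
      by metis
    have xR: "x \<in> carrier ?R" using x(1) by (simp add: PiE_iff)
    from coincide[OF xR] have "eventually (\<lambda>c. \<psi> c (x (fst c)) = g) V"
      by (auto simp: \<psi>_def x(2) elim!: eventually_mono)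
    with xR show "\<exists>x\<in>carrier ?R. eventually (\<lambda>c. \<psi> c (x (fst c)) = g) V" by blast
  qed (use V P assms in auto)
  with P ultrafilter_filtermap[OF V] show ?thesis by blast
qed

end
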